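(* For every integer $m\ge0$, $$\sum_{n=0}^{\infty}(-1)^n\frac{1}{16^n}\binom{2n}{n}^2\frac{1}{n+m+1}=\frac{2}{\pi}\int_0^1\frac{x^m}{\sqrt{1+x}}\,K\!\left(\sqrt{\frac{x}{1+x}}\right)dx$$ $$=\frac{(-1)^m16^m}{\sqrt2\,\pi^{3/2}(2m+1)^2\binom{2m}{m}^2}\sum_{j=0}^{m}(-1)^j\frac{\binom{2j}{j}^2}{16^j}\left\{(4j+1)\,\Gamma\!\left(\tfrac14\right)^2-4\,\Gamma\!\left(\tfrac34\right)^2\right\}.$$
   Context: $K(k)=\int_0^{\pi/2}\frac{d\theta}{\sqrt{1-k^2\sin^2\theta}}$ is the complete elliptic integral of the first kind in the modulus convention. *)

theory Defs
  imports "HOL-Analysis.Analysis"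
begin

text \<open>The argument is the modulus \<open>k\<close>, not the parameter \<open>k\<^sup>2\<close>.\<close>

definition complete_elliptic_K :: "real \<Rightarrow> real" where
  "complete_elliptic_K k = integral {0..pi / 2} (\<lambda>\<theta>. 1 / sqrt (1 - k\<^sup>2 * (sin \<theta>)\<^sup>2))"

end

theory Submission imports Defs begin

text \<open>
  Write \<open>w n = (2n choose n) / 4 ^ n\<close>, so that the summand is \<open>(-1) ^ n * (w n)\<^sup>2 / (n + m + 1)\<close>, and let
  \<open>S m\<close> be its sum.

  The integral. The number \<open>w n\<close> is, up to sign, the \<open>n\<close>-th coefficient of \<open>1 / sqrt (1 + y)\<close> and
  also, up to the factor \<open>\<pi> / 2\<close>, the integral of \<open>cos \<theta> ^ (2 * n)\<close> over a quarter period.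
  Since \<open>K (sqrt (x / (1 + x))) / sqrt (1 + x)\<close> is the integral of \<open>1 / sqrt (1 + x * (cos \<theta>)\<^sup>2)\<close>,
  expanding the integrand gives the series with coefficients \<open>(-1) ^ n * (w n)\<^sup>2\<close>, and integrating it
  against \<open>x ^ m\<close> gives \<open>S m\<close>. The binomial series sits at its radius of convergence here, but
  it alternates with decreasing terms, so its \<open>N\<close>-th remainder is at most \<open>w N\<close> on all of \<open>[0, 1]\<close>
  (\<open>inverse_sqrt_partial_sum_error\<close>). This one uniform bound justifies both termwise integrations,
  first in \<open>\<theta>\<close> and then in \<open>x\<close>.

  The closed form. Let \<open>L\<close> be the sum of \<open>(-1) ^ n * (w n)\<^sup>2\<close>. The ratio
  \<open>w (n + 1) / w n = (2 * n + 1) / (2 * n + 2)\<close> makes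
  the combination \<open>(2 * m + 3)\<^sup>2 * S (m + 1) + 4 * (m + 1)\<^sup>2 * S m - S 0 - 8 * (m + 1) * L\<close> telescope to \<open>0\<close>
  (\<open>alternating_moment_recurrence\<close>). Multiplied by \<open>(w (m + 1))\<^sup>2\<close>, this is a first-order recurrence for
  \<open>(2 * m + 1)\<^sup>2 * (w m)\<^sup>2 * S m\<close>, whose solution is the finite sum in the theorem. It remains to know \<open>L\<close> and \<open>S 0\<close>.
  The expansion used before identifies them with the lemniscatic integrals of \<open>1 / sqrt (1 + (cos \<theta>)\<^sup>2)\<close> and
  \<open>(sin \<theta>)\<^sup>2 / sqrt (1 + (cos \<theta>)\<^sup>2)\<close>, which the substitution \<open>t = cos \<theta> ^ 4\<close> turns into the Beta values
  \<open>B(1/4, 1/2)\<close> and \<open>B(3/4, 1/2)\<close> (\<open>Beta_half_eq_cos_integral\<close>).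
\<close>

section \<open>Normalised central binomial coefficients\<close>

definition wallis_ratio :: "nat \<Rightarrow> real"
  where "wallis_ratio n = real ((2 * n) choose n) / 4 ^ n"

lemma wallis_ratio_0 [simp]: "wallis_ratio 0 = 1"
  by (simp add: wallis_ratio_def)

lemma wallis_ratio_Suc:
  "wallis_ratio (Suc n) = (2 * real n + 1) / (2 * real n + 2) * wallis_ratio n"
proof -
  have fact_form: "real ((2 * k) choose k) = fact (2 * k) / (fact k)\<^sup>2" for k
    using binomial_fact[of k "2 * k", where ?'a = real] by (simp add: power2_eq_square mult_2)
  have "(fact (2 * Suc n) :: real) = (2 * real n + 2) * (2 * real n + 1) * fact (2 * n)"
    by (simp add: algebra_simps)
  moreover have "(fact (Suc n) :: real) = (real n + 1) * fact n"
    by (simp add: algebra_simps)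
  moreover have "real n + 1 \<noteq> 0" "2 * real n + 2 \<noteq> 0" by linarith+
  moreover have "(fact n :: real) \<noteq> 0" by simp
  ultimately show ?thesis
    unfolding wallis_ratio_def fact_form
    by (simp add: divide_simps power2_eq_square) (simp add: algebra_simps)
qed

lemma wallis_ratio_pos: "0 < wallis_ratio n"
  by (simp add: wallis_ratio_def)

lemma wallis_ratio_Suc_le: "wallis_ratio (Suc n) \<le> wallis_ratio n"
  unfolding wallis_ratio_Suc using wallis_ratio_pos[of n]
  by (intro mult_left_le_one_le) (auto simp: divide_simps)

text \<open>
  The induction needs the explicit rate \<open>(w n)\<^sup>2 \<le> 1 / (2 * n + 1)\<close>, which is preserved because
  \<open>(2 * n + 1) * (2 * n + 3) \<le> (2 * n + 2)\<^sup>2\<close>.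
\<close>

lemma wallis_ratio_tendsto_0: "wallis_ratio \<longlonglongrightarrow> 0"
proof -
  have sq: "(wallis_ratio n)\<^sup>2 \<le> 1 / (2 * real n + 1)" for n
  proof (induction n)
    case (Suc n)
    have "(wallis_ratio (Suc n))\<^sup>2 = ((2 * real n + 1) / (2 * real n + 2))\<^sup>2 * (wallis_ratio n)\<^sup>2"
      by (simp only: wallis_ratio_Suc power_mult_distrib)
    also have "\<dots> \<le> ((2 * real n + 1) / (2 * real n + 2))\<^sup>2 * (1 / (2 * real n + 1))"
      by (intro mult_left_mono Suc) auto
    also have "\<dots> = (2 * real n + 1) / (2 * real n + 2)\<^sup>2"
      by (simp add: power2_eq_square)
    also have "\<dots> \<le> 1 / (2 * real (Suc n) + 1)"
      by (simp add: divide_simps power2_eq_square) (simp add: algebra_simps)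
    finally show ?case .
  qed simp
  have "(\<lambda>n. (wallis_ratio n)\<^sup>2) \<longlonglongrightarrow> 0"
  proof (rule tendsto_sandwich[where f = "\<lambda>_. 0"])
    have "1 / (2 * real n + 1) \<le> inverse (real (Suc n))" for n
      by (simp add: divide_simps)
    then have "(wallis_ratio n)\<^sup>2 \<le> inverse (real (Suc n))" for n
      using sq[of n] order_trans by blast
    then show "\<forall>\<^sub>F n in sequentially. (wallis_ratio n)\<^sup>2 \<le> inverse (real (Suc n))"
      by simp
  qed (use LIMSEQ_inverse_real_of_nat in auto)
  from tendsto_real_sqrt[OF this] show ?thesis
    using wallis_ratio_pos by (simp add: less_imp_le)
qed

section \<open>The binomial series of the inverse square root\<close>

lemma gbinomial_minus_half: "(-1/2 :: real) gchoose n = (-1) ^ n * wallis_ratio n"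
proof (induction n)
  case (Suc n)
  have "(-1/2 :: real) gchoose Suc n = (-1/2 - real n) / (real n + 1) * ((-1/2) gchoose n)"
    using gbinomial_mult_1[of "-1/2 :: real" n] by (simp add: field_simps)
  then show ?case unfolding Suc wallis_ratio_Suc
    by (simp add: divide_simps) (simp add: algebra_simps)
qed simp

text \<open>
  For \<open>y < 1\<close> the binomial series converges and alternates with decreasing terms, so Leibniz' criterion
  bounds the remainder by the first omitted term. Both sides are continuous in \<open>y\<close>, so the bound
  survives at \<open>y = 1\<close>, where the binomial theorem for \<open>\<bar>y\<bar> < 1\<close> says nothing.
\<close>

lemma inverse_sqrt_partial_sum_error:
  assumes "0 \<le> y" "y \<le> 1"
  shows "\<bar>1 / sqrt (1 + y) - (\<Sum>n<N. (-1) ^ n * wallis_ratio n * y ^ n)\<bar> \<le> wallis_ratio N"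
proof -
  define err where "err y = \<bar>1 / sqrt (1 + y) - (\<Sum>n<N. (-1) ^ n * wallis_ratio n * y ^ n)\<bar>" for y
  have inside: "err y \<le> wallis_ratio N" if y: "y \<in> {0..<1}" for y
  proof -
    define b where "b n = wallis_ratio n * y ^ n" for n
    have b0: "0 \<le> b n" for n using y wallis_ratio_pos[of n] by (simp add: b_def)
    have mono: "b (Suc n) \<le> b n" for n
      unfolding b_def using y wallis_ratio_pos[of "Suc n"] wallis_ratio_Suc_le[of n]
      by (intro mult_mono) (auto intro: mult_left_le_one_le)
    have le: "b n \<le> wallis_ratio n" for n
      unfolding b_def using y wallis_ratio_pos[of n] by (simp add: mult_left_le power_le_one)
    have lim: "b \<longlonglongrightarrow> 0"
      by (rule tendsto_sandwich[OF _ _ tendsto_const wallis_ratio_tendsto_0]) (use b0 le in auto)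
    note L = summable_Leibniz'[of b, OF lim b0 mono]
    have "(\<lambda>n. ((-1/2) gchoose n) * y ^ n) sums (1 + y) powr (-1/2)"
      using gen_binomial_real[of y "-1/2"] y by simp
    moreover have "(1 + y) powr (-1/2) = 1 / sqrt (1 + y)"
      using y by (simp add: powr_minus_divide powr_half_sqrt)
    ultimately have "(\<lambda>n. (-1) ^ n * b n) sums (1 / sqrt (1 + y))"
      unfolding gbinomial_minus_half by (simp add: b_def mult.assoc)
    then have s: "(\<Sum>n. (-1) ^ n * b n) = 1 / sqrt (1 + y)" by (simp add: sums_iff)
    have "\<bar>1 / sqrt (1 + y) - (\<Sum>n<N. (-1) ^ n * b n)\<bar> \<le> b N"
    proof (cases "even N")
      case True
      then obtain k where "N = 2 * k" by auto
      then show ?thesis using L(2,4)[of k] s by auto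
    next
      case False
      then obtain k where k: "N = 2 * k + 1" by (auto elim: oddE)
      then show ?thesis using L(2)[of "Suc k"] L(4)[of k] s by auto
    qed
    then show ?thesis using le[of N] by (simp add: err_def b_def mult.assoc)
  qed
  have "err y \<le> wallis_ratio N"
  proof (rule continuous_le_on_closure[where S = "{0..<1}" and f = err])
    show "continuous_on (closure {0..<1}) err"
      unfolding err_def by (simp, intro continuous_intros) auto
  qed (use assms inside in auto)
  then show ?thesis by (simp add: err_def)
qed

text \<open>
  The explicit error bound of the integrated series is kept besides its convergence: the
  \<open>\<theta>\<close>-integral of the series is integrated once more in \<open>x\<close>, which requires the error to be uniform in \<open>x\<close>.
\<close>

lemma termwise_integration:
  fixes f :: "real \<Rightarrow> real"
  assumes err: "\<And>N t. t \<in> {a..b} \<Longrightarrow> \<bar>f t - (\<Sum>n<N. u n t)\<bar> \<le> e N"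
    and e: "e \<longlonglongrightarrow> 0" and ab: "a \<le> b"
    and u: "\<And>n. (u n has_integral M n) {a..b}"
  shows "f integrable_on {a..b}"
    and "\<bar>integral {a..b} f - (\<Sum>n<N. M n)\<bar> \<le> e N * (b - a)"
    and "M sums integral {a..b} f"
proof -
  have part: "((\<lambda>t. \<Sum>n<N. u n t) has_integral (\<Sum>n<N. M n)) {a..b}" for N
    by (intro has_integral_sum u) auto
  show int: "f integrable_on {a..b}"
  proof (rule integrable_uniform_limit_real)
    fix d :: real assume "d > 0"
    then obtain N where "e N < d" using order_tendstoD(2)[OF e] by (auto simp: eventually_sequentially)
    then show "\<exists>g. (\<forall>x\<in>{a..b}. norm (f x - g x) \<le> d) \<and> g integrable_on {a..b}"
      using err[of _ N] part[of N]
      by (intro exI[of _ "\<lambda>t. \<Sum>n<N. u n t"]) (force simp: has_integral_integrable)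
  qed
  show bound: "\<bar>integral {a..b} f - (\<Sum>n<N. M n)\<bar> \<le> e N * (b - a)" for N
  proof -
    have "((\<lambda>t. f t - (\<Sum>n<N. u n t)) has_integral (integral {a..b} f - (\<Sum>n<N. M n))) {a..b}"
      by (intro has_integral_diff integrable_integral int part)
    moreover have "0 \<le> e N" using err[of a N] ab by force
    ultimately have "norm (integral {a..b} f - (\<Sum>n<N. M n)) \<le> e N * measure lborel (cbox a b)"
      using err by (intro has_integral_bound[where f = "\<lambda>t. f t - (\<Sum>n<N. u n t)"]) auto
    then show ?thesis using ab by simp
  qed
  show "M sums integral {a..b} f"
    unfolding sums_def
  proof (rule LIM_zero_cancel, rule tendsto_rabs_zero_cancel, rule tendsto_sandwich[where f = "\<lambda>_. 0"])
    show "(\<lambda>N. e N * (b - a)) \<longlonglongrightarrow> 0" using tendsto_mult_left_zero[OF e] by simp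
  qed (use bound in \<open>auto simp: abs_minus_commute\<close>)
qed

section \<open>Wallis integrals\<close>

text \<open>
  The derivative of \<open>sin \<theta> * cos \<theta> ^ (2 * n + 1)\<close> is a combination of the two integrands, and this function
  vanishes at both endpoints.
\<close>

lemma cos_power_moment_Suc:
  assumes "((\<lambda>\<theta>. cos \<theta> ^ (2 * n)) has_integral I) {0..pi/2}"
  shows "((\<lambda>\<theta>. cos \<theta> ^ (2 * Suc n)) has_integral (2 * real n + 1) / (2 * real n + 2) * I) {0..pi/2}"
proof -
  have "((\<lambda>\<theta>. (2 * real n + 2) * cos \<theta> ^ (2 * Suc n) - (2 * real n + 1) * cos \<theta> ^ (2 * n))
      has_integral (sin (pi/2) * cos (pi/2) ^ (2 * n + 1) - sin 0 * cos 0 ^ (2 * n + 1))) {0..pi/2}"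
  proof (rule fundamental_theorem_of_calculus)
    fix x :: real
    have s2: "sin x * sin x = 1 - cos x * cos x"
      using sin_cos_squared_add[of x] by (simp add: power2_eq_square)
    have "((\<lambda>\<theta>. sin \<theta> * cos \<theta> ^ (2 * n + 1)) has_real_derivative
        cos x * cos x ^ (2 * n + 1) - (sin x * sin x) * ((2 * real n + 1) * cos x ^ (2 * n))) (at x)"
      by (rule DERIV_cong[OF DERIV_mult[OF DERIV_sin DERIV_power[OF DERIV_cos]]])
        (simp add: algebra_simps)
    also have "cos x * cos x ^ (2 * n + 1) - (sin x * sin x) * ((2 * real n + 1) * cos x ^ (2 * n))
        = (2 * real n + 2) * cos x ^ (2 * Suc n) - (2 * real n + 1) * cos x ^ (2 * n)"
      unfolding s2 by (simp add: algebra_simps)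
    finally show "((\<lambda>\<theta>. sin \<theta> * cos \<theta> ^ (2 * n + 1)) has_vector_derivative
        (2 * real n + 2) * cos x ^ (2 * Suc n) - (2 * real n + 1) * cos x ^ (2 * n)) (at x within {0..pi/2})"
      by (simp add: has_real_derivative_iff_has_vector_derivative[symmetric] has_field_derivative_at_within)
  qed simp
  then have "((\<lambda>\<theta>. ((2 * real n + 2) * cos \<theta> ^ (2 * Suc n) - (2 * real n + 1) * cos \<theta> ^ (2 * n))
      + (2 * real n + 1) * cos \<theta> ^ (2 * n)) has_integral (0 + (2 * real n + 1) * I)) {0..pi/2}"
    by (intro has_integral_add has_integral_mult_right assms) simp
  then have "((\<lambda>\<theta>. (2 * real n + 2) * cos \<theta> ^ (2 * Suc n)) has_integral (2 * real n + 1) * I) {0..pi/2}"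
    by simp
  from has_integral_mult_right[OF this, of "1 / (2 * real n + 2)"] show ?thesis
    by (simp add: add_pos_nonneg)
qed

lemma cos_power_moment: "((\<lambda>\<theta>. cos \<theta> ^ (2 * n)) has_integral pi/2 * wallis_ratio n) {0..pi/2}"
proof (induction n)
  case 0
  show ?case using has_integral_const_real[of "1::real" 0 "pi/2"] by (simp add: real_scaleR_def)
next
  case (Suc n)
  from cos_power_moment_Suc[OF Suc] show ?case by (simp only: wallis_ratio_Suc ac_simps)
qed

lemma sin_squared_cos_power_moment:
  "((\<lambda>\<theta>. (sin \<theta>)\<^sup>2 * cos \<theta> ^ (2 * n)) has_integral pi/4 * wallis_ratio n / (real n + 1)) {0..pi/2}"
proof -
  have "((\<lambda>\<theta>. cos \<theta> ^ (2 * n) - cos \<theta> ^ (2 * Suc n)) has_integral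
      (pi/2 * wallis_ratio n - pi/2 * wallis_ratio (Suc n))) {0..pi/2}"
    by (intro has_integral_diff cos_power_moment)
  moreover have "cos \<theta> ^ (2 * n) - cos \<theta> ^ (2 * Suc n) = (sin \<theta>)\<^sup>2 * cos \<theta> ^ (2 * n)" for \<theta> :: real
    unfolding sin_squared_eq by (simp add: algebra_simps power2_eq_square)
  moreover have "pi/2 * wallis_ratio n - pi/2 * wallis_ratio (Suc n) = pi/4 * wallis_ratio n / (real n + 1)"
    unfolding wallis_ratio_Suc by (simp add: divide_simps) (simp add: algebra_simps)
  ultimately show ?thesis by simp
qed


section \<open>Lemniscatic integrals as Gamma values\<close>

lemma cos_power4_image: "(\<lambda>\<theta>. cos \<theta> ^ 4) ` {0<..<pi/2} = {0<..<1::real}"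
proof (intro equalityI subsetI)
  fix t :: real
  assume "t \<in> (\<lambda>\<theta>. cos \<theta> ^ 4) ` {0<..<pi/2}"
  then obtain \<theta> where \<theta>: "0 < \<theta>" "\<theta> < pi/2" and t: "t = cos \<theta> ^ 4" by auto
  have "0 < cos \<theta>" using \<theta> by (intro cos_gt_zero) auto
  moreover have "cos \<theta> < cos 0" using \<theta> pi_gt_zero by (intro cos_monotone_0_pi) linarith+
  ultimately show "t \<in> {0<..<1}" using t by (simp add: power_less_one_iff)
next
  fix t :: real
  assume t: "t \<in> {0<..<1}"
  define r where "r = root 4 t"
  have r: "0 < r" "r < 1" "r ^ 4 = t" using t by (auto simp: r_def)
  then have "0 < arccos r" "arccos r < pi/2" "cos (arccos r) = r"
    using arccos_lt_bounded[of r] arccos_less_arccos[of 0 r] by auto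
  then show "t \<in> (\<lambda>\<theta>. cos \<theta> ^ 4) ` {0<..<pi/2}"
    using r by (intro image_eqI[of _ _ "arccos r"]) auto
qed

text \<open>
  Substitute \<open>t = cos \<theta> ^ 4\<close> in Euler's integral for \<open>Beta a (1/2)\<close>. The factorisation
  \<open>1 - cos \<theta> ^ 4 = (sin \<theta>)\<^sup>2 * (1 + (cos \<theta>)\<^sup>2)\<close> lets the factor \<open>sin \<theta>\<close> of \<open>dt\<close> cancel, which leaves
  \<open>sqrt (1 + (cos \<theta>)\<^sup>2)\<close>. The interval is open because Euler's integrand may be singular at both ends.
\<close>

lemma Beta_half_eq_cos_integral:
  assumes "0 < a"
  shows "((\<lambda>\<theta>. cos \<theta> powr (4 * a - 1) / sqrt (1 + (cos \<theta>)\<^sup>2)) has_integral Beta a (1/2) / 4) {0<..<pi/2}"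
proof -
  define f where "f t = t powr (a - 1) * (1 - t) powr (1/2 - 1)" for t :: real
  define g' where "g' \<theta> = - (4 * cos \<theta> ^ 3 * sin \<theta>)" for \<theta> :: real
  have "(f has_integral Beta a (1/2)) {0<..<1}"
    using has_integral_Beta_real[of a "1/2"] assms by (simp add: f_def [abs_def] has_integral_Icc_iff_Ioo)
  then have f_Beta: "f absolutely_integrable_on {0<..<1} \<and> integral {0<..<1} f = Beta a (1/2)"
    by (auto simp: f_def has_integral_integrable_integral intro!: nonnegative_absolutely_integrable_1)
  have deriv: "((\<lambda>\<theta>. cos \<theta> ^ 4) has_field_derivative g' x) (at x within {0<..<pi/2})" for x
    by (auto intro!: derivative_eq_intros simp: g'_def)
  have inj: "inj_on (\<lambda>\<theta>. cos \<theta> ^ 4 :: real) {0<..<pi/2}"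
  proof (rule inj_onI)
    fix x y :: real
    assume xy: "x \<in> {0<..<pi/2}" "y \<in> {0<..<pi/2}" "cos x ^ 4 = cos y ^ 4"
    then have "0 \<le> cos x" "0 \<le> cos y" by (auto intro!: cos_ge_zero)
    then have "cos x = cos y" using xy(3) by (simp add: power_eq_iff_eq_base)
    moreover have "0 \<le> x" "x \<le> pi" "0 \<le> y" "y \<le> pi" using xy(1,2) by auto
    ultimately show "x = y" using cos_inj_pi by blast
  qed
  have "(\<lambda>\<theta>. \<bar>g' \<theta>\<bar> * f (cos \<theta> ^ 4)) absolutely_integrable_on {0<..<pi/2} \<and>
      integral {0<..<pi/2} (\<lambda>\<theta>. \<bar>g' \<theta>\<bar> * f (cos \<theta> ^ 4)) = Beta a (1/2)"
    using f_Beta has_absolute_integral_change_of_variables_1'[OF _ deriv inj, of f "Beta a (1/2)"]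
    unfolding cos_power4_image by simp
  then have "((\<lambda>\<theta>. \<bar>g' \<theta>\<bar> * f (cos \<theta> ^ 4)) has_integral Beta a (1/2)) {0<..<pi/2}"
    by (auto simp: has_integral_integrable_integral absolutely_integrable_on_def)
  moreover have "\<bar>g' \<theta>\<bar> * f (cos \<theta> ^ 4) = 4 * (cos \<theta> powr (4 * a - 1) / sqrt (1 + (cos \<theta>)\<^sup>2))"
    if "\<theta> \<in> {0<..<pi/2}" for \<theta>
  proof -
    have c: "0 < cos \<theta>" using that by (intro cos_gt_zero) auto
    have s: "0 < sin \<theta>" using that by (intro sin_gt_zero) auto
    have p4: "cos \<theta> ^ 4 = cos \<theta> powr 4" and p3: "cos \<theta> ^ 3 = cos \<theta> powr 3"
      using c by (simp_all add: powr_numeral)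
    have "1 - cos \<theta> ^ 4 = (1 - (cos \<theta>)\<^sup>2) * (1 + (cos \<theta>)\<^sup>2)"
      by (simp add: algebra_simps power2_eq_square power4_eq_xxxx)
    also have "\<dots> = (sin \<theta>)\<^sup>2 * (1 + (cos \<theta>)\<^sup>2)" by (simp add: sin_squared_eq)
    finally have "(1 - cos \<theta> ^ 4) powr (1/2 - 1) = 1 / (sin \<theta> * sqrt (1 + (cos \<theta>)\<^sup>2))"
      using s by (simp add: powr_minus_divide powr_half_sqrt real_sqrt_mult)
    moreover have "cos \<theta> ^ 3 * (cos \<theta> ^ 4) powr (a - 1) = cos \<theta> powr (4 * a - 1)"
      unfolding p3 p4 powr_powr powr_add[symmetric] by (simp add: algebra_simps)
    moreover have "\<bar>g' \<theta>\<bar> = 4 * sin \<theta> * cos \<theta> ^ 3" using c s by (simp add: g'_def abs_mult)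
    ultimately show ?thesis using s by (simp add: f_def field_simps)
  qed
  ultimately have "((\<lambda>\<theta>. 4 * (cos \<theta> powr (4 * a - 1) / sqrt (1 + (cos \<theta>)\<^sup>2))) has_integral Beta a (1/2)) {0<..<pi/2}"
    by (rule has_integral_eq[rotated])
  from has_integral_mult_right[OF this, of "1/4"] show ?thesis by simp
qed

lemma Gamma_quarter_reflection: "Gamma (1/4) * Gamma (3/4 :: real) = sqrt 2 * pi"
proof -
  have "complex_of_real (Gamma (1/4) * Gamma (3/4)) = Gamma (of_real (1/4)) * Gamma (1 - of_real (1/4))"
    by (simp add: Gamma_complex_of_real[symmetric])
  also have "\<dots> = of_real pi / sin (of_real pi * of_real (1/4))"
    by (rule Gamma_reflection_complex)
  also have "\<dots> = of_real (pi / sin (pi / 4))"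
    by (simp only: of_real_mult[symmetric] sin_of_real of_real_divide[symmetric]) simp
  finally have "Gamma (1/4) * Gamma (3/4 :: real) = pi / sin (pi / 4)"
    by (simp only: of_real_eq_iff)
  also have "\<dots> = sqrt 2 * pi" by (simp add: sin_45 field_simps)
  finally show ?thesis .
qed

text \<open>
  The cases \<open>a = 1/4\<close> and \<open>a = 3/4\<close> of the substitution. The reflection formula at \<open>1/4\<close> removes the
  quotients of Gamma values and leaves one square in each.
\<close>

lemma lemniscate_integrals:
  shows "((\<lambda>\<theta>. 1 / sqrt (1 + (cos \<theta>)\<^sup>2)) has_integral (Gamma (1/4))\<^sup>2 / (4 * sqrt 2 * sqrt pi)) {0..pi/2}"
    and "((\<lambda>\<theta>. (cos \<theta>)\<^sup>2 / sqrt (1 + (cos \<theta>)\<^sup>2)) has_integral (Gamma (3/4))\<^sup>2 / (sqrt 2 * sqrt pi)) {0..pi/2}"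
proof -
  have pos: "cos \<theta> > 0" if "\<theta> \<in> {0<..<pi/2}" for \<theta> :: real
    using that by (intro cos_gt_zero) auto
  have G: "Gamma (1/4 :: real) > 0" "Gamma (3/4 :: real) > 0" by (auto intro: Gamma_real_pos)
  have pp: "pi = sqrt pi * sqrt pi" by simp
  have "Beta (1/4) (1/2) / 4 = Gamma (1/4) * sqrt pi / Gamma (3/4 :: real) / 4"
    by (simp add: Beta_def Gamma_one_half_real)
  also have "\<dots> = (Gamma (1/4))\<^sup>2 * sqrt pi / (4 * (Gamma (1/4) * Gamma (3/4)))"
    using G by (simp add: power2_eq_square)
  also have "\<dots> = (Gamma (1/4))\<^sup>2 / (4 * sqrt 2 * sqrt pi)"
    unfolding Gamma_quarter_reflection by (subst (3) pp) (simp add: field_simps)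
  finally have B1: "Beta (1/4) (1/2) / 4 = (Gamma (1/4 :: real))\<^sup>2 / (4 * sqrt 2 * sqrt pi)" .
  have "Gamma (5/4 :: real) = 1/4 * Gamma (1/4)"
    using Gamma_plus1[of "1/4 :: real"] nonpos_Ints_nonpos[of "1/4 :: real"] by auto
  then have "Beta (3/4) (1/2) / 4 = Gamma (3/4) * sqrt pi / Gamma (1/4 :: real)"
    by (simp add: Beta_def Gamma_one_half_real)
  also have "\<dots> = (Gamma (3/4))\<^sup>2 * sqrt pi / (Gamma (1/4) * Gamma (3/4))"
    using G by (simp add: power2_eq_square)
  also have "\<dots> = (Gamma (3/4))\<^sup>2 / (sqrt 2 * sqrt pi)"
    unfolding Gamma_quarter_reflection by (subst (3) pp) (simp add: field_simps)
  finally have B2: "Beta (3/4) (1/2) / 4 = (Gamma (3/4 :: real))\<^sup>2 / (sqrt 2 * sqrt pi)" .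
  have "((\<lambda>\<theta>. 1 / sqrt (1 + (cos \<theta>)\<^sup>2)) has_integral Beta (1/4) (1/2) / 4) {0<..<pi/2}"
    by (rule has_integral_eq[OF _ Beta_half_eq_cos_integral[of "1/4"]], frule pos) simp_all
  then show "((\<lambda>\<theta>. 1 / sqrt (1 + (cos \<theta>)\<^sup>2)) has_integral (Gamma (1/4))\<^sup>2 / (4 * sqrt 2 * sqrt pi)) {0..pi/2}"
    by (simp only: B1 has_integral_Icc_iff_Ioo)
  have "((\<lambda>\<theta>. (cos \<theta>)\<^sup>2 / sqrt (1 + (cos \<theta>)\<^sup>2)) has_integral Beta (3/4) (1/2) / 4) {0<..<pi/2}"
    by (rule has_integral_eq[OF _ Beta_half_eq_cos_integral[of "3/4"]], frule pos) (simp_all add: powr_numeral)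
  then show "((\<lambda>\<theta>. (cos \<theta>)\<^sup>2 / sqrt (1 + (cos \<theta>)\<^sup>2)) has_integral (Gamma (3/4))\<^sup>2 / (sqrt 2 * sqrt pi)) {0..pi/2}"
    by (simp only: B2 has_integral_Icc_iff_Ioo)
qed


section \<open>The series as a moment of the elliptic integral\<close>

lemma elliptic_K_as_cos_integral:
  assumes "0 \<le> x"
  shows "1 / sqrt (1 + x) * complete_elliptic_K (sqrt (x / (1 + x)))
    = integral {0..pi/2} (\<lambda>\<theta>. 1 / sqrt (1 + x * (cos \<theta>)\<^sup>2))"
proof -
  have "1 / sqrt (1 + x) * (1 / sqrt (1 - (sqrt (x / (1 + x)))\<^sup>2 * (sin \<theta>)\<^sup>2))
      = 1 / sqrt (1 + x * (cos \<theta>)\<^sup>2)" for \<theta>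
  proof -
    have "(1 + x) * (1 - (sqrt (x / (1 + x)))\<^sup>2 * (sin \<theta>)\<^sup>2) = 1 + x * (cos \<theta>)\<^sup>2"
      using assms by (simp add: cos_squared_eq field_simps)
    then show ?thesis by (simp flip: real_sqrt_mult)
  qed
  then show ?thesis
    unfolding complete_elliptic_K_def by (simp flip: integral_mult_right)
qed

text \<open>
  Expanding \<open>1 / sqrt (1 + x * (cos \<theta>)\<^sup>2)\<close> and integrating in \<open>\<theta>\<close> produces one factor \<open>wallis_ratio n\<close>
  from the binomial series and another one from the Wallis integral. The error does not depend on \<open>x\<close>.
\<close>

lemma elliptic_K_series_error:
  assumes "0 \<le> x" "x \<le> 1"
  shows "\<bar>1 / sqrt (1 + x) * complete_elliptic_K (sqrt (x / (1 + x)))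
      - (\<Sum>n<N. (-1) ^ n * (pi/2 * (wallis_ratio n)\<^sup>2) * x ^ n)\<bar> \<le> wallis_ratio N * (pi/2)"
proof -
  have y: "0 \<le> x * (cos \<theta>)\<^sup>2" "x * (cos \<theta>)\<^sup>2 \<le> 1" for \<theta>
    using assms by (auto intro!: mult_le_one simp: abs_square_le_1)
  have "((\<lambda>\<theta>. (-1) ^ n * wallis_ratio n * (x * (cos \<theta>)\<^sup>2) ^ n) has_integral
      (-1) ^ n * (pi/2 * (wallis_ratio n)\<^sup>2) * x ^ n) {0..pi/2}" for n
    using has_integral_mult_right[OF cos_power_moment, of "(-1) ^ n * wallis_ratio n * x ^ n" n]
    by (simp add: power_mult_distrib power_mult power2_eq_square mult_ac)
  from termwise_integration(2)[OF inverse_sqrt_partial_sum_error[OF y] wallis_ratio_tendsto_0 _ this, of N]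
  show ?thesis unfolding elliptic_K_as_cos_integral[OF assms(1)] by simp
qed

definition alternating_moment :: "nat \<Rightarrow> nat \<Rightarrow> real"
  where "alternating_moment m n = (-1) ^ n * (wallis_ratio n)\<^sup>2 / real (n + m + 1)"

lemma elliptic_K_moment:
  defines "F \<equiv> \<lambda>x. 1 / sqrt (1 + x) * complete_elliptic_K (sqrt (x / (1 + x)))"
  shows "(\<lambda>x. x ^ m * F x) integrable_on {0..1}"
    and "alternating_moment m sums (2 / pi * integral {0..1} (\<lambda>x. x ^ m * F x))"
proof -
  define u where "u n x = x ^ m * ((-1) ^ n * (pi/2 * (wallis_ratio n)\<^sup>2) * x ^ n)" for n x
  have err: "\<bar>x ^ m * F x - (\<Sum>n<N. u n x)\<bar> \<le> wallis_ratio N * (pi/2)" if x: "x \<in> {0..1}" for x N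
  proof -
    have "x ^ m * F x - (\<Sum>n<N. u n x)
        = x ^ m * (F x - (\<Sum>n<N. (-1) ^ n * (pi/2 * (wallis_ratio n)\<^sup>2) * x ^ n))"
      by (simp add: u_def right_diff_distrib sum_distrib_left)
    also have "\<bar>\<dots>\<bar> \<le> 1 * (wallis_ratio N * (pi/2))"
      unfolding abs_mult F_def using x elliptic_K_series_error[of x N]
      by (intro mult_mono) (auto simp: power_le_one)
    finally show ?thesis by simp
  qed
  have u_int: "(u n has_integral pi/2 * alternating_moment m n) {0..1}" for n
  proof -
    have "((\<lambda>x::real. x ^ (n + m)) has_integral (1 ^ (n + m + 1) / real (n + m + 1) - 0 ^ (n + m + 1) / real (n + m + 1))) {0..1}"
    proof (rule fundamental_theorem_of_calculus)
      fix x :: real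
      have "((\<lambda>x. x ^ (n + m + 1) / real (n + m + 1)) has_real_derivative x ^ (n + m)) (at x within {0..1})"
        by (rule DERIV_cong[OF DERIV_cdivide[OF DERIV_pow]]) simp
      then show "((\<lambda>x. x ^ (n + m + 1) / real (n + m + 1)) has_vector_derivative x ^ (n + m)) (at x within {0..1})"
        by (simp add: has_real_derivative_iff_has_vector_derivative)
    qed simp
    from has_integral_mult_right[OF this, of "(-1) ^ n * (pi/2 * (wallis_ratio n)\<^sup>2)"]
    show ?thesis by (simp add: u_def [abs_def] alternating_moment_def power_add mult_ac)
  qed
  have e: "(\<lambda>N. wallis_ratio N * (pi/2)) \<longlonglongrightarrow> 0"
    using tendsto_mult_left_zero[OF wallis_ratio_tendsto_0] by simp
  show "(\<lambda>x. x ^ m * F x) integrable_on {0..1}"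
    by (rule termwise_integration(1)[OF err e _ u_int]) simp_all
  have "(\<lambda>n. pi/2 * alternating_moment m n) sums integral {0..1} (\<lambda>x. x ^ m * F x)"
    by (rule termwise_integration(3)[OF err e _ u_int]) simp_all
  from sums_mult[OF this, of "2 / pi"]
  show "alternating_moment m sums (2 / pi * integral {0..1} (\<lambda>x. x ^ m * F x))"
    by simp
qed

section \<open>The two initial values\<close>

text \<open>
  Both sums come from the expansion of \<open>1 / sqrt (1 + (cos \<theta>)\<^sup>2)\<close>, that is, from the endpoint \<open>x = 1\<close>.
  With the weight \<open>(sin \<theta>)\<^sup>2\<close> the Wallis integral of index \<open>n\<close> acquires the factor \<open>1 / (2 * (n + 1))\<close>,
  which is the denominator of \<open>alternating_moment 0\<close>; so the sum for \<open>m = 0\<close> is a single lemniscatic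
  integral and no double integral has to be evaluated.
\<close>

lemma alternating_moment_base_values:
  defines "c \<equiv> 1 / (sqrt 2 * pi powr (3/2))"
  shows "(\<lambda>n. (-1) ^ n * (wallis_ratio n)\<^sup>2) sums (c / 2 * (Gamma (1/4))\<^sup>2)"
    and "alternating_moment 0 sums (c * ((Gamma (1/4))\<^sup>2 - 4 * (Gamma (3/4))\<^sup>2))"
proof -
  have c: "c = 1 / (sqrt 2 * (pi * sqrt pi))"
    using powr_add[of pi 1 "1/2"] by (simp add: c_def powr_half_sqrt)
  have y: "0 \<le> (cos \<theta>)\<^sup>2" "(cos \<theta>)\<^sup>2 \<le> 1" for \<theta> :: real
    by (auto simp: abs_square_le_1)
  note err = inverse_sqrt_partial_sum_error[OF y]
  have u1: "((\<lambda>\<theta>. (-1) ^ n * wallis_ratio n * ((cos \<theta>)\<^sup>2) ^ n) has_integral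
      pi/2 * ((-1) ^ n * (wallis_ratio n)\<^sup>2)) {0..pi/2}" for n
    using has_integral_mult_right[OF cos_power_moment, of "(-1) ^ n * wallis_ratio n" n]
    by (simp add: power_mult power_mult_distrib power2_eq_square mult_ac)
  have "(\<lambda>n. pi/2 * ((-1) ^ n * (wallis_ratio n)\<^sup>2)) sums integral {0..pi/2} (\<lambda>\<theta>. 1 / sqrt (1 + (cos \<theta>)\<^sup>2))"
    by (rule termwise_integration(3)[OF err wallis_ratio_tendsto_0 _ u1]) simp
  from sums_mult[OF this, of "2 / pi"]
  show "(\<lambda>n. (-1) ^ n * (wallis_ratio n)\<^sup>2) sums (c / 2 * (Gamma (1/4))\<^sup>2)"
    unfolding integral_unique[OF lemniscate_integrals(1)] by (simp add: c mult_ac)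
  have err2: "\<bar>(sin \<theta>)\<^sup>2 / sqrt (1 + (cos \<theta>)\<^sup>2) - (\<Sum>n<N. (sin \<theta>)\<^sup>2 * ((-1) ^ n * wallis_ratio n * ((cos \<theta>)\<^sup>2) ^ n))\<bar>
      \<le> wallis_ratio N" for \<theta> N
  proof -
    have "(sin \<theta>)\<^sup>2 / sqrt (1 + (cos \<theta>)\<^sup>2) - (\<Sum>n<N. (sin \<theta>)\<^sup>2 * ((-1) ^ n * wallis_ratio n * ((cos \<theta>)\<^sup>2) ^ n))
      = (sin \<theta>)\<^sup>2 * (1 / sqrt (1 + (cos \<theta>)\<^sup>2) - (\<Sum>n<N. (-1) ^ n * wallis_ratio n * ((cos \<theta>)\<^sup>2) ^ n))"
      by (simp add: right_diff_distrib sum_distrib_left)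
    also have "\<bar>\<dots>\<bar> \<le> 1 * wallis_ratio N"
      unfolding abs_mult by (intro mult_mono err) (auto simp: abs_square_le_1)
    finally show ?thesis by simp
  qed
  have u2: "((\<lambda>\<theta>. (sin \<theta>)\<^sup>2 * ((-1) ^ n * wallis_ratio n * ((cos \<theta>)\<^sup>2) ^ n)) has_integral
      pi/4 * alternating_moment 0 n) {0..pi/2}" for n
    using has_integral_mult_right[OF sin_squared_cos_power_moment, of "(-1) ^ n * wallis_ratio n" n]
    by (simp add: alternating_moment_def power_mult power_mult_distrib power2_eq_square mult_ac add_ac)
  have "(\<lambda>n. pi/4 * alternating_moment 0 n) sums integral {0..pi/2} (\<lambda>\<theta>. (sin \<theta>)\<^sup>2 / sqrt (1 + (cos \<theta>)\<^sup>2))"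
    by (rule termwise_integration(3)[OF err2 wallis_ratio_tendsto_0 _ u2]) simp
  moreover have "integral {0..pi/2} (\<lambda>\<theta>. (sin \<theta>)\<^sup>2 / sqrt (1 + (cos \<theta>)\<^sup>2))
      = (Gamma (1/4))\<^sup>2 / (4 * sqrt 2 * sqrt pi) - (Gamma (3/4))\<^sup>2 / (sqrt 2 * sqrt pi)"
    using integral_unique[OF has_integral_diff[OF lemniscate_integrals]]
    by (simp add: sin_squared_eq diff_divide_distrib)
  ultimately have "(\<lambda>n. pi/4 * alternating_moment 0 n) sums
      ((Gamma (1/4))\<^sup>2 / (4 * sqrt 2 * sqrt pi) - (Gamma (3/4))\<^sup>2 / (sqrt 2 * sqrt pi))"
    by (simp only:)
  then have "(\<lambda>n. 4 / pi * (pi/4 * alternating_moment 0 n)) sums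
      (4 / pi * ((Gamma (1/4))\<^sup>2 / (4 * sqrt 2 * sqrt pi) - (Gamma (3/4))\<^sup>2 / (sqrt 2 * sqrt pi)))"
    by (rule sums_mult)
  moreover have "4 / pi * ((Gamma (1/4))\<^sup>2 / (4 * sqrt 2 * sqrt pi) - (Gamma (3/4))\<^sup>2 / (sqrt 2 * sqrt pi))
      = c * ((Gamma (1/4))\<^sup>2 - 4 * (Gamma (3/4 :: real))\<^sup>2)"
    unfolding c by (simp add: field_simps)
  ultimately show "alternating_moment 0 sums (c * ((Gamma (1/4))\<^sup>2 - 4 * (Gamma (3/4))\<^sup>2))"
    by simp
qed

section \<open>The recurrence in the exponent\<close>

text \<open>
  The sum telescopes because, in terms of \<open>p n = (-1) ^ n * (wallis_ratio n)\<^sup>2\<close>, consecutive terms satisfy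
  \<open>p (n + 1) * (n + 1)\<^sup>2 = - p n * (n + 1/2)\<^sup>2\<close>. With \<open>M = m + 1\<close>, write
  \<open>(M + 1/2)\<^sup>2 = (n + M + 1) * (M - n) + (n + 1/2)\<^sup>2\<close> and \<open>M\<^sup>2 = (n + M) * (M - n) + n\<^sup>2\<close>: the last summands,
  divided by \<open>n + M + 1\<close> and \<open>n + M\<close>, cancel in consecutive terms, and the rest is \<open>2 * (M - n) * p n\<close>.
  The series of \<open>n * p n\<close> does not converge; subtracting the same identity for \<open>M = 0\<close>, which is the
  term \<open>alternating_moment 0 n\<close>, removes it. The right-hand side is what remains of the two boundary terms.
\<close>

lemma alternating_moment_recurrence_partial:
  "(\<Sum>n<N. (2 * real m + 3)\<^sup>2 * alternating_moment (Suc m) n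
        + 4 * (real m + 1)\<^sup>2 * alternating_moment m n - alternating_moment 0 n
        - 8 * (real m + 1) * ((-1) ^ n * (wallis_ratio n)\<^sup>2))
    = 4 * (-1) ^ N * (wallis_ratio N)\<^sup>2 * ((real m + 1) * real N / (real N + real m + 1))"
proof (induction N)
  case (Suc N)
  define p where "p = (-1) ^ N * (wallis_ratio N)\<^sup>2"
  define M where "M = real m"
  define x where "x = real N"
  have nz: "x + M + 1 \<noteq> 0" "x + M + 2 \<noteq> 0" "x + 1 \<noteq> 0" by (simp_all add: x_def M_def add_nonneg_eq_0_iff)
  have w: "(-1) ^ Suc N * (wallis_ratio (Suc N))\<^sup>2 = - p * (2 * x + 1)\<^sup>2 / (4 * (x + 1)\<^sup>2)"
    unfolding wallis_ratio_Suc by (simp add: p_def x_def power_mult_distrib power_divide) (simp add: field_simps power2_eq_square)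
  \<comment> \<open>The induction step, divided by the common factor \<open>p\<close>, is an identity of rational functions.\<close>
  have id: "4 * ((M + 1) * x / (x + M + 1)) + (2 * M + 3)\<^sup>2 / (x + M + 2) + 4 * (M + 1)\<^sup>2 / (x + M + 1)
      - 1 / (x + 1) - 8 * (M + 1)
      = - (2 * x + 1)\<^sup>2 / (x + 1)\<^sup>2 * ((M + 1) * (x + 1) / (x + M + 2))"
    using nz by (simp add: divide_simps) algebra
  have "4 * p * ((M + 1) * x / (x + M + 1)) + ((2 * M + 3)\<^sup>2 * (p / (x + M + 2))
      + 4 * (M + 1)\<^sup>2 * (p / (x + M + 1)) - p / (x + 1) - 8 * (M + 1) * p)
     = p * (4 * ((M + 1) * x / (x + M + 1)) + (2 * M + 3)\<^sup>2 / (x + M + 2) + 4 * (M + 1)\<^sup>2 / (x + M + 1)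
      - 1 / (x + 1) - 8 * (M + 1))"
    by (simp add: algebra_simps)
  also have "\<dots> = 4 * (- p * (2 * x + 1)\<^sup>2 / (4 * (x + 1)\<^sup>2)) * ((M + 1) * (x + 1) / (x + M + 2))"
    unfolding id by simp
  finally show ?case
    unfolding sum.lessThan_Suc Suc mult.assoc[of 4 "(-1) ^ Suc N"] w
    by (simp add: alternating_moment_def p_def M_def x_def add_ac mult_ac)
qed simp

lemma alternating_moment_recurrence:
  assumes "alternating_moment (Suc m) sums S'" "alternating_moment m sums S" "alternating_moment 0 sums S0"
    and "(\<lambda>n. (-1) ^ n * (wallis_ratio n)\<^sup>2) sums L"
  shows "(2 * real m + 3)\<^sup>2 * S' + 4 * (real m + 1)\<^sup>2 * S = S0 + 8 * (real m + 1) * L"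
proof -
  have remainder: "(\<lambda>N. 4 * (-1) ^ N * (wallis_ratio N)\<^sup>2 * ((real m + 1) * real N / (real N + real m + 1))) \<longlonglongrightarrow> 0"
  proof (rule tendsto_rabs_zero_cancel, rule tendsto_sandwich[where f = "\<lambda>_. 0"])
    have "\<bar>4 * (-1) ^ N * (wallis_ratio N)\<^sup>2 * ((real m + 1) * real N / (real N + real m + 1))\<bar>
        \<le> 4 * (wallis_ratio N)\<^sup>2 * (real m + 1)" for N
    proof -
      define q where "q = (real m + 1) * real N / (real N + real m + 1)"
      have "q \<le> real m + 1"
        by (simp add: q_def divide_simps add_nonneg_eq_0_iff algebra_simps)
      moreover have "0 \<le> q" by (simp add: q_def)
      ultimately show ?thesis
        unfolding q_def[symmetric] by (simp add: abs_mult mult_left_mono)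
    qed
    then show "\<forall>\<^sub>F N in sequentially. \<bar>4 * (-1) ^ N * (wallis_ratio N)\<^sup>2 * ((real m + 1) * real N / (real N + real m + 1))\<bar>
        \<le> 4 * (wallis_ratio N)\<^sup>2 * (real m + 1)" by simp
    have "(\<lambda>N. 4 * (wallis_ratio N)\<^sup>2 * (real m + 1)) \<longlonglongrightarrow> 4 * 0\<^sup>2 * (real m + 1)"
      by (intro tendsto_intros wallis_ratio_tendsto_0)
    then show "(\<lambda>N. 4 * (wallis_ratio N)\<^sup>2 * (real m + 1)) \<longlonglongrightarrow> 0" by simp
  qed simp_all
  have "(\<lambda>n. (2 * real m + 3)\<^sup>2 * alternating_moment (Suc m) n
        + 4 * (real m + 1)\<^sup>2 * alternating_moment m n - alternating_moment 0 n
        - 8 * (real m + 1) * ((-1) ^ n * (wallis_ratio n)\<^sup>2))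
      sums ((2 * real m + 3)\<^sup>2 * S' + 4 * (real m + 1)\<^sup>2 * S - S0 - 8 * (real m + 1) * L)"
    by (intro sums_diff sums_add sums_mult assms)
  then have "(2 * real m + 3)\<^sup>2 * S' + 4 * (real m + 1)\<^sup>2 * S - S0 - 8 * (real m + 1) * L = 0"
    unfolding sums_def alternating_moment_recurrence_partial by (rule LIMSEQ_unique[OF _ remainder])
  then show ?thesis by simp
qed

section \<open>The closed form\<close>

text \<open>
  Multiplying the recurrence by \<open>(wallis_ratio (Suc m))\<^sup>2\<close> turns the coefficient of \<open>S m\<close> into that of the
  induction hypothesis, by \<open>2 * (m + 1) * wallis_ratio (Suc m) = (2 * m + 1) * wallis_ratio m\<close>. The inhomogeneous part
  \<open>S 0 + 8 * (m + 1) * L\<close> is \<open>c * ((4 * (m + 1) + 1) * A - 4 * B)\<close>, which the multiplication turns into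
  \<open>(-1) ^ (m + 1) * c\<close> times the new summand.
\<close>

lemma alternating_moment_closed_form:
  fixes A B c :: real
  assumes S: "\<And>m. alternating_moment m sums S m"
    and S0: "S 0 = c * (A - 4 * B)"
    and L: "(\<lambda>n. (-1) ^ n * (wallis_ratio n)\<^sup>2) sums (c / 2 * A)"
  shows "(2 * real m + 1)\<^sup>2 * (wallis_ratio m)\<^sup>2 * S m
    = (-1) ^ m * c * (\<Sum>j = 0..m. (-1) ^ j * (wallis_ratio j)\<^sup>2 * ((4 * real j + 1) * A - 4 * B))"
proof (induction m)
  case 0
  show ?case by (simp add: S0)
next
  case (Suc m)
  define T where "T k = (\<Sum>j = 0..k. (-1) ^ j * (wallis_ratio j)\<^sup>2 * ((4 * real j + 1) * A - 4 * B))" for k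
  have rec: "(2 * real m + 3)\<^sup>2 * S (Suc m) = c * ((4 * real (Suc m) + 1) * A - 4 * B) - 4 * (real m + 1)\<^sup>2 * S m"
    using alternating_moment_recurrence[OF S S S L, of m] unfolding S0 by (simp add: algebra_simps)
  have w: "4 * (real m + 1)\<^sup>2 * (wallis_ratio (Suc m))\<^sup>2 = (2 * real m + 1)\<^sup>2 * (wallis_ratio m)\<^sup>2"
  proof -
    have "(2 * (real m + 1)) * wallis_ratio (Suc m) = (2 * real m + 1) * wallis_ratio m"
      unfolding wallis_ratio_Suc by (simp add: divide_simps)
    from arg_cong[OF this, of "\<lambda>x. x\<^sup>2"] show ?thesis
      unfolding power_mult_distrib by simp
  qed
  have "(2 * real (Suc m) + 1)\<^sup>2 * (wallis_ratio (Suc m))\<^sup>2 * S (Suc m)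
      = (wallis_ratio (Suc m))\<^sup>2 * ((2 * real m + 3)\<^sup>2 * S (Suc m))"
    by (simp add: algebra_simps)
  also have "\<dots> = c * ((wallis_ratio (Suc m))\<^sup>2 * ((4 * real (Suc m) + 1) * A - 4 * B))
      - (4 * (real m + 1)\<^sup>2 * (wallis_ratio (Suc m))\<^sup>2) * S m"
    unfolding rec by (simp only: right_diff_distrib mult_ac)
  also have "\<dots> = c * ((wallis_ratio (Suc m))\<^sup>2 * ((4 * real (Suc m) + 1) * A - 4 * B)) - (-1) ^ m * c * T m"
    unfolding w Suc T_def ..
  also have "\<dots> = (-1) ^ Suc m * c * T (Suc m)"
    unfolding T_def sum.atLeast0_atMost_Suc by (simp add: algebra_simps flip: power_add mult_2 power_mult)
  finally show ?case unfolding T_def .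
qed

theorem theorem3p7:
  fixes m :: nat
  shows
    "summable (\<lambda>n. (-1) ^ n * (1 / 16 ^ n) * (real ((2 * n) choose n))\<^sup>2 * (1 / real (n + m + 1))) \<and>
     (\<lambda>x. x ^ m / sqrt (1 + x) * complete_elliptic_K (sqrt (x / (1 + x)))) integrable_on {0..1} \<and>
     (\<Sum>n. (-1) ^ n * (1 / 16 ^ n) * (real ((2 * n) choose n))\<^sup>2 * (1 / real (n + m + 1)))
       = 2 / pi * integral {0..1}
           (\<lambda>x. x ^ m / sqrt (1 + x) * complete_elliptic_K (sqrt (x / (1 + x)))) \<and>
     2 / pi * integral {0..1}
           (\<lambda>x. x ^ m / sqrt (1 + x) * complete_elliptic_K (sqrt (x / (1 + x))))
       = (-1) ^ m * 16 ^ m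
           / (sqrt 2 * pi powr (3 / 2) * (2 * real m + 1)\<^sup>2 * (real ((2 * m) choose m))\<^sup>2)
         * (\<Sum>j = 0..m. (-1) ^ j * ((real ((2 * j) choose j))\<^sup>2 / 16 ^ j)
              * ((4 * real j + 1) * (Gamma (1 / 4))\<^sup>2 - 4 * (Gamma (3 / 4))\<^sup>2))"
proof -
  define S where "S k = 2 / pi * integral {0..1}
      (\<lambda>x. x ^ k / sqrt (1 + x) * complete_elliptic_K (sqrt (x / (1 + x))))" for k
  have w: "(wallis_ratio n)\<^sup>2 = (real ((2 * n) choose n))\<^sup>2 / 16 ^ n" for n
    by (simp add: wallis_ratio_def power_divide flip: power_mult power_mult_distrib)
      (simp add: power_mult mult.commute[of n])
  have S: "alternating_moment k sums S k" for k
    using elliptic_K_moment(2)[of k] by (simp add: S_def)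
  have "S 0 = 1 / (sqrt 2 * pi powr (3/2)) * ((Gamma (1/4))\<^sup>2 - 4 * (Gamma (3/4))\<^sup>2)"
    using sums_unique2[OF S alternating_moment_base_values(2)] .
  note closed = alternating_moment_closed_form[OF S this alternating_moment_base_values(1), of m, unfolded w]
  have t: "(\<lambda>n. (-1) ^ n * (1 / 16 ^ n) * (real ((2 * n) choose n))\<^sup>2 * (1 / real (n + m + 1))) = alternating_moment m"
    by (simp add: fun_eq_iff alternating_moment_def w)
  have nz: "(2 * real m + 1)\<^sup>2 \<noteq> 0" "(real ((2 * m) choose m))\<^sup>2 \<noteq> 0"
    by (simp_all add: add_nonneg_eq_0_iff)
  have "S m = ((2 * real m + 1)\<^sup>2 * ((real ((2 * m) choose m))\<^sup>2 / 16 ^ m) * S m)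
      * (16 ^ m / ((2 * real m + 1)\<^sup>2 * (real ((2 * m) choose m))\<^sup>2))"
    using nz by simp
  also have "\<dots> = (-1) ^ m * 16 ^ m
           / (sqrt 2 * pi powr (3 / 2) * (2 * real m + 1)\<^sup>2 * (real ((2 * m) choose m))\<^sup>2)
         * (\<Sum>j = 0..m. (-1) ^ j * ((real ((2 * j) choose j))\<^sup>2 / 16 ^ j)
              * ((4 * real j + 1) * (Gamma (1 / 4))\<^sup>2 - 4 * (Gamma (3 / 4))\<^sup>2))"
    unfolding closed by (simp add: mult_ac)
  finally have final: "S m = \<dots>" .
  have "(\<lambda>x. x ^ m / sqrt (1 + x) * complete_elliptic_K (sqrt (x / (1 + x)))) integrable_on {0..1}"
    using elliptic_K_moment(1)[of m] by simp
  moreover have "summable (alternating_moment m)" "suminf (alternating_moment m) = S m"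
    using S[of m] by (simp_all add: sums_iff)
  ultimately show ?thesis unfolding t using final unfolding S_def by (intro conjI) simp_all
qed

end
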